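(* Let $(A,\Phi,F)$ be a finite multi-model and let $\sigma$ be an automorphism of the algebra $A$. For each $f\in F$ define an interpretation $f^\sigma$ of $\Phi$ in $A$ by: for each $n$-ary $\varphi\in\Phi$ and each tuple $(a_1,\dots,a_n)$ of elements of $A$, $(a_1,\dots,a_n)\in f^\sigma(\varphi)$ if and only if $(\sigma^{-1}(a_1),\dots,\sigma^{-1}(a_n))\in f(\varphi)$. Let $F_1=\{f^\sigma : f\in F\}$. Then $f\mapsto f^\sigma$ is a bijection $F\to F_1$; for every $f\in F$ the map $\sigma$ is an isomorphism of models from $(A,\Phi,f)$ onto $(A,\Phi,f^\sigma)$, and $\mathrm{Aut}(f^\sigma)=\sigma\,\mathrm{Aut}(f)\,\sigma^{-1}$. Consequently the multi-models $(A,\Phi,F)$ and $(A,\Phi,F_1)$ are automorphically equivalent.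
   Context: A model is a triple $(D,\Phi,f)$ where $D$ is an algebra in a variety $\Theta$ (possibly multi-sorted), $\Phi$ is a set of relation symbols, and $f$ is an interpretation of these symbols in $D$: for an $n$-ary $\varphi\in\Phi$, $f(\varphi)\subseteq D^n$ (in the multi-sorted case, a subset of the product of sorts given by the type of $\varphi$). A multi-model is a triple $(D,\Phi,F)$ where $F$ is a set of interpretations of $\Phi$ in $D$; all multi-models are assumed finite. For a model $(D,\Phi,f)$, $\mathrm{Aut}(f)$ is the group of all bijections $s:D\to D$ (sort-preserving in the multi-sorted case) such that for every $n$-ary $\varphi\in\Phi$ and every $(a_1,\dots,a_n)\in f(\varphi)$ one has $(sa_1,\dots,sa_n)\in f(\varphi)$. An isomorphism of models $(A,\Phi,f_1)\to(B,\Phi,f_2)$ is an isomorphism of algebras $\sigma:A\to B$ such that for every $n$-ary $\varphi\in\Phi$, $(a_1,\dots,a_n)\in f_1(\varphi)$ if and only if $(\sigma(a_1),\dots,\sigma(a_n))\in f_2(\varphi)$. Two models $(A,\Phi_1,f_1)$, $(B,\Phi_2,f_2)$ are automorphically equivalent if there is an isomorphism of algebras $\mu:A\to B$ with $\mathrm{Aut}(f_2)=\mu\,\mathrm{Aut}(f_1)\,\mu^{-1}$. Two multi-models $(A,\Phi_1,F_1)$, $(B,\Phi_2,F_2)$ are automorphically equivalent if there is a bijection $\alpha:F_1\to F_2$ such that $(A,\Phi_1,f)$ and $(B,\Phi_2,f^\alpha)$ are automorphically equivalent for every $f\in F_1$. *)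

theory Defs
  imports "HOL-Library.FuncSet" "HOL-Algebra.Bij"
begin

text \<open>Sorts are the elements of the type \<open>'s\<close>; the one-sorted case is \<open>'s = unit\<close>.
  A variety is presented by a signature and a set of identities. The two sides of an identity
  come with a context, the list of sorts of the variables \<open>Var 0, Var 1, \<dots>\<close>, over which the
  identity is quantified; carriers are thus allowed to be empty.\<close>

datatype 'o trm = Var nat | App 'o "'o trm list"

record ('s, 'o) variety =
  op_symbols :: "'o set"
  op_args :: "'o \<Rightarrow> 's list"
  op_res :: "'o \<Rightarrow> 's"
  identities :: "('s list \<times> 'o trm \<times> 'o trm) set"

record ('s, 'o, 'a) algebra =
  sort_carrier :: "'s \<Rightarrow> 'a set"
  op :: "'o \<Rightarrow> 'a list \<Rightarrow> 'a"

record ('s, 'r) relations =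
  rel_symbols :: "'r set"
  rel_type :: "'r \<Rightarrow> 's list"

inductive has_sort :: "('s, 'o) variety \<Rightarrow> 's list \<Rightarrow> 'o trm \<Rightarrow> 's \<Rightarrow> bool"
  for \<Theta> :: "('s, 'o) variety" and \<Gamma> :: "'s list" where
  Var: "i < length \<Gamma> \<Longrightarrow> has_sort \<Theta> \<Gamma> (Var i) (\<Gamma> ! i)"
| App: "\<omega> \<in> op_symbols \<Theta> \<Longrightarrow> list_all2 (has_sort \<Theta> \<Gamma>) ts (op_args \<Theta> \<omega>) \<Longrightarrow>
    has_sort \<Theta> \<Gamma> (App \<omega> ts) (op_res \<Theta> \<omega>)"

definition is_variety :: "('s, 'o) variety \<Rightarrow> bool" where
  "is_variety \<Theta> \<longleftrightarrow>
    (\<forall>(\<Gamma>, t, u) \<in> identities \<Theta>. \<exists>s. has_sort \<Theta> \<Gamma> t s \<and> has_sort \<Theta> \<Gamma> u s)"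

definition tuples :: "('s, 'o, 'a) algebra \<Rightarrow> 's list \<Rightarrow> 'a list set" where
  "tuples D ss = {xs. list_all2 (\<lambda>s x. x \<in> sort_carrier D s) ss xs}"

primrec eval_trm :: "('s, 'o, 'a) algebra \<Rightarrow> 'a list \<Rightarrow> 'o trm \<Rightarrow> 'a" where
  "eval_trm D xs (Var i) = xs ! i"
| "eval_trm D xs (App \<omega> ts) = op D \<omega> (map (eval_trm D xs) ts)"

definition in_variety :: "('s, 'o) variety \<Rightarrow> ('s, 'o, 'a) algebra \<Rightarrow> bool" where
  "in_variety \<Theta> D \<longleftrightarrow>
    (\<forall>\<omega> \<in> op_symbols \<Theta>. \<forall>xs \<in> tuples D (op_args \<Theta> \<omega>).
       op D \<omega> xs \<in> sort_carrier D (op_res \<Theta> \<omega>)) \<and>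
    (\<forall>(\<Gamma>, t, u) \<in> identities \<Theta>. \<forall>xs \<in> tuples D \<Gamma>. eval_trm D xs t = eval_trm D xs u)"

text \<open>A sort-preserving map is a family of maps indexed by the sorts; \<open>map2 \<sigma> ss xs\<close> is its
  action on a tuple \<open>xs\<close> of type \<open>ss\<close>. Only the values on the carriers matter.\<close>

definition family_inv ::
    "('s, 'o, 'a) algebra \<Rightarrow> ('s \<Rightarrow> 'a \<Rightarrow> 'b) \<Rightarrow> 's \<Rightarrow> 'b \<Rightarrow> 'a" where
  "family_inv A \<sigma> s = inv_into (sort_carrier A s) (\<sigma> s)"

definition algebra_iso ::
    "('s, 'o) variety \<Rightarrow> ('s, 'o, 'a) algebra \<Rightarrow> ('s, 'o, 'b) algebra \<Rightarrow>
     ('s \<Rightarrow> 'a \<Rightarrow> 'b) \<Rightarrow> bool" where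
  "algebra_iso \<Theta> A B \<sigma> \<longleftrightarrow>
    (\<forall>s. bij_betw (\<sigma> s) (sort_carrier A s) (sort_carrier B s)) \<and>
    (\<forall>\<omega> \<in> op_symbols \<Theta>. \<forall>xs \<in> tuples A (op_args \<Theta> \<omega>).
       \<sigma> (op_res \<Theta> \<omega>) (op A \<omega> xs) = op B \<omega> (map2 \<sigma> (op_args \<Theta> \<omega>) xs))"

abbreviation algebra_aut ::
    "('s, 'o) variety \<Rightarrow> ('s, 'o, 'a) algebra \<Rightarrow> ('s \<Rightarrow> 'a \<Rightarrow> 'a) \<Rightarrow> bool" where
  "algebra_aut \<Theta> A \<equiv> algebra_iso \<Theta> A A"

text \<open>Interpretations are extensional outside the relation symbols, so that equality of
  interpretations is equality on the symbols.\<close>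

definition interpretations ::
    "('s, 'o, 'a) algebra \<Rightarrow> ('s, 'r) relations \<Rightarrow> ('r \<Rightarrow> 'a list set) set" where
  "interpretations D \<Phi> = (\<Pi>\<^sub>E \<phi> \<in> rel_symbols \<Phi>. Pow (tuples D (rel_type \<Phi> \<phi>)))"

type_synonym ('s, 'o, 'a, 'r) model =
  "('s, 'o, 'a) algebra \<times> ('s, 'r) relations \<times> ('r \<Rightarrow> 'a list set)"

type_synonym ('s, 'o, 'a, 'r) multi_model =
  "('s, 'o, 'a) algebra \<times> ('s, 'r) relations \<times> ('r \<Rightarrow> 'a list set) set"

text \<open>Finiteness is finiteness of the underlying algebra, sort by sort; the set of relation
  symbols may be infinite.\<close>

fun finite_multi_model :: "('s, 'o) variety \<Rightarrow> ('s, 'o, 'a, 'r) multi_model \<Rightarrow> bool" where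
  "finite_multi_model \<Theta> (D, \<Phi>, F) \<longleftrightarrow>
    in_variety \<Theta> D \<and> (\<forall>s. finite (sort_carrier D s)) \<and> F \<subseteq> interpretations D \<Phi>"

text \<open>The bijections in \<open>Aut\<close> need not preserve the operations of the algebra. They are
  extensional, being in \<open>Bij\<close>, so equality of sets of such families is the intended one.\<close>

fun Aut :: "('s, 'o, 'a, 'r) model \<Rightarrow> ('s \<Rightarrow> 'a \<Rightarrow> 'a) set" where
  "Aut (D, \<Phi>, f) =
    {g. (\<forall>s. g s \<in> Bij (sort_carrier D s)) \<and>
        (\<forall>\<phi> \<in> rel_symbols \<Phi>. \<forall>xs \<in> f \<phi>. map2 g (rel_type \<Phi> \<phi>) xs \<in> f \<phi>)}"

definition conjugate ::
    "('s, 'o, 'a) algebra \<Rightarrow> ('s, 'o, 'b) algebra \<Rightarrow> ('s \<Rightarrow> 'a \<Rightarrow> 'b) \<Rightarrow>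
     ('s \<Rightarrow> 'a \<Rightarrow> 'a) \<Rightarrow> 's \<Rightarrow> 'b \<Rightarrow> 'b" where
  "conjugate A B \<mu> g = (\<lambda>s. \<lambda>x \<in> sort_carrier B s. \<mu> s (g s (family_inv A \<mu> s x)))"

definition model_iso ::
    "('s, 'o) variety \<Rightarrow> ('s, 'r) relations \<Rightarrow>
     ('s, 'o, 'a) algebra \<Rightarrow> ('r \<Rightarrow> 'a list set) \<Rightarrow>
     ('s, 'o, 'b) algebra \<Rightarrow> ('r \<Rightarrow> 'b list set) \<Rightarrow> ('s \<Rightarrow> 'a \<Rightarrow> 'b) \<Rightarrow> bool" where
  "model_iso \<Theta> \<Phi> A f1 B f2 \<sigma> \<longleftrightarrow>
    algebra_iso \<Theta> A B \<sigma> \<and>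
    (\<forall>\<phi> \<in> rel_symbols \<Phi>. \<forall>xs \<in> tuples A (rel_type \<Phi> \<phi>).
       xs \<in> f1 \<phi> \<longleftrightarrow> map2 \<sigma> (rel_type \<Phi> \<phi>) xs \<in> f2 \<phi>)"

fun aut_equiv_models ::
    "('s, 'o) variety \<Rightarrow> ('s, 'o, 'a, 'r) model \<Rightarrow> ('s, 'o, 'b, 'q) model \<Rightarrow> bool" where
  "aut_equiv_models \<Theta> (A, \<Phi>1, f1) (B, \<Phi>2, f2) \<longleftrightarrow>
    (\<exists>\<mu>. algebra_iso \<Theta> A B \<mu> \<and> Aut (B, \<Phi>2, f2) = conjugate A B \<mu> ` Aut (A, \<Phi>1, f1))"

fun aut_equiv_multi_models ::
    "('s, 'o) variety \<Rightarrow> ('s, 'o, 'a, 'r) multi_model \<Rightarrow> ('s, 'o, 'b, 'q) multi_model \<Rightarrow> bool"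
where
  "aut_equiv_multi_models \<Theta> (A, \<Phi>1, F1) (B, \<Phi>2, F2) \<longleftrightarrow>
    (\<exists>\<alpha>. bij_betw \<alpha> F1 F2 \<and> (\<forall>f \<in> F1. aut_equiv_models \<Theta> (A, \<Phi>1, f) (B, \<Phi>2, \<alpha> f)))"

definition transport ::
    "('s, 'o, 'a) algebra \<Rightarrow> ('s, 'r) relations \<Rightarrow> ('s \<Rightarrow> 'a \<Rightarrow> 'a) \<Rightarrow>
     ('r \<Rightarrow> 'a list set) \<Rightarrow> 'r \<Rightarrow> 'a list set" where
  "transport A \<Phi> \<sigma> f = (\<lambda>\<phi> \<in> rel_symbols \<Phi>.
    {xs \<in> tuples A (rel_type \<Phi> \<phi>). map2 (family_inv A \<sigma>) (rel_type \<Phi> \<phi>) xs \<in> f \<phi>})"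

end

theory Submission imports Defs begin

text \<open>An isomorphism of models \<open>\<mu>\<close> moves the tuples of \<open>f\<^sub>1\<close> to those of \<open>f\<^sub>2\<close> and back, so
  conjugation by \<open>\<mu>\<close> maps \<open>Aut f\<^sub>1\<close> into \<open>Aut f\<^sub>2\<close>, and conjugation by \<open>\<mu>\<inverse>\<close> maps back. The
  interpretation \<open>f\<^sup>\<sigma>\<close> is defined exactly so that \<open>\<sigma>\<close> is an isomorphism from \<open>f\<close>, and \<open>f\<close> is
  recovered from \<open>f\<^sup>\<sigma>\<close> by applying \<open>\<sigma>\<close> to tuples.\<close>

lemma tuples_iff_nth:
  "xs \<in> tuples D ss \<longleftrightarrow>
    length xs = length ss \<and> (\<forall>i < length ss. xs ! i \<in> sort_carrier D (ss ! i))"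
  by (auto simp: tuples_def list_all2_conv_all_nth)

lemma map2_in_tuples:
  assumes "\<And>s x. x \<in> sort_carrier A s \<Longrightarrow> g s x \<in> sort_carrier B s" "xs \<in> tuples A ss"
  shows "map2 g ss xs \<in> tuples B ss"
  using assms by (simp add: tuples_iff_nth)

lemma map2_map2_same:
  assumes "length xs = length ss"
  shows "map2 g ss (map2 h ss xs) = map2 (\<lambda>s x. g s (h s x)) ss xs"
  using assms by (intro nth_equalityI) auto

lemma map2_ident_tuples:
  assumes "xs \<in> tuples A ss" "\<And>s x. x \<in> sort_carrier A s \<Longrightarrow> g s x = x"
  shows "map2 g ss xs = xs"
  using assms by (intro nth_equalityI) (auto simp: tuples_iff_nth)

context
  fixes A :: "('s, 'o, 'a) algebra" and B :: "('s, 'o, 'b) algebra"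
    and \<mu> :: "'s \<Rightarrow> 'a \<Rightarrow> 'b"
  assumes bij: "\<And>s. bij_betw (\<mu> s) (sort_carrier A s) (sort_carrier B s)"
begin

text \<open>The inverse family satisfies the assumption of this context with \<open>A\<close> and
  \<open>B\<close> exchanged, so every lemma proved here for \<open>\<mu>\<close> can also be used
  for \<open>family_inv A \<mu>\<close>.\<close>

lemma bij_betw_family_inv:
  "bij_betw (family_inv A \<mu> s) (sort_carrier B s) (sort_carrier A s)"
  unfolding family_inv_def by (rule bij_betw_inv_into[OF bij])

lemma family_closed: "x \<in> sort_carrier A s \<Longrightarrow> \<mu> s x \<in> sort_carrier B s"
  by (rule bij_betwE[OF bij, rule_format])

lemma family_inv_closed: "x \<in> sort_carrier B s \<Longrightarrow> family_inv A \<mu> s x \<in> sort_carrier A s"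
  by (rule bij_betwE[OF bij_betw_family_inv, rule_format])

lemma family_inv_left: "x \<in> sort_carrier A s \<Longrightarrow> family_inv A \<mu> s (\<mu> s x) = x"
  unfolding family_inv_def by (rule bij_betw_inv_into_left[OF bij])

lemma family_inv_right: "x \<in> sort_carrier B s \<Longrightarrow> \<mu> s (family_inv A \<mu> s x) = x"
  unfolding family_inv_def by (rule bij_betw_inv_into_right[OF bij])

text \<open>Conjugation by the inverse family involves the inverse of that family; this identifies
  it with \<open>\<mu>\<close>, on the carriers only, because \<open>inv_into\<close> is arbitrary
  elsewhere.\<close>

lemma family_inv_family_inv:
  "x \<in> sort_carrier A s \<Longrightarrow> family_inv B (family_inv A \<mu>) s x = \<mu> s x"
  unfolding family_inv_def[of B]
  by (metis bij_betw_imp_inj_on bij_betw_family_inv family_closed family_inv_left inv_into_f_f)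

lemma map2_family_inv_left:
  assumes "xs \<in> tuples A ss"
  shows "map2 (family_inv A \<mu>) ss (map2 \<mu> ss xs) = xs"
  using assms by (subst map2_map2_same)
    (auto simp: tuples_iff_nth intro: map2_ident_tuples[of _ A] family_inv_left)

lemma map2_family_inv_right:
  assumes "xs \<in> tuples B ss"
  shows "map2 \<mu> ss (map2 (family_inv A \<mu>) ss xs) = xs"
  using assms by (subst map2_map2_same)
    (auto simp: tuples_iff_nth intro: map2_ident_tuples[of _ B] family_inv_right)

lemma conjugate_Bij:
  assumes "g s \<in> Bij (sort_carrier A s)"
  shows "conjugate A B \<mu> g s \<in> Bij (sort_carrier B s)"
proof -
  have "bij_betw (\<mu> s \<circ> (g s \<circ> family_inv A \<mu> s)) (sort_carrier B s) (sort_carrier B s)"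
    using assms bij_betw_trans[OF bij_betw_trans[OF bij_betw_family_inv] bij]
    by (auto simp: Bij_def comp_assoc)
  \<comment> \<open>The conjugate is restricted to the carrier and the composite is not, so they
    agree only there. The restriction supplies the extensionality that \<open>Bij\<close>
    demands.\<close>
  moreover have "bij_betw (conjugate A B \<mu> g s) (sort_carrier B s) (sort_carrier B s) \<longleftrightarrow>
      bij_betw (\<mu> s \<circ> (g s \<circ> family_inv A \<mu> s)) (sort_carrier B s) (sort_carrier B s)"
    by (intro bij_betw_cong) (simp add: conjugate_def)
  ultimately show ?thesis
    by (simp add: Bij_def conjugate_def)
qed

text \<open>Gives surjectivity of conjugation on automorphism groups: it exhibits a preimage of each
  \<open>g\<close>.\<close>

lemma conjugate_conjugate_family_inv:
  assumes "\<And>s. g s \<in> Bij (sort_carrier B s)"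
  shows "conjugate A B \<mu> (conjugate B A (family_inv A \<mu>) g) = g"
proof (intro ext)
  fix s x
  show "conjugate A B \<mu> (conjugate B A (family_inv A \<mu>) g) s x = g s x"
  proof (cases "x \<in> sort_carrier B s")
    case True
    then have "g s x \<in> sort_carrier B s"
      using assms[of s] by (auto simp: Bij_def dest: bij_betwE)
    with True show ?thesis
      by (simp add: conjugate_def family_inv_family_inv family_inv_closed family_inv_right)
  next
    \<comment> \<open>Both sides are \<open>undefined\<close> here: the left by the restriction in
      \<open>conjugate\<close>, the right because \<open>Bij\<close> is extensional.\<close>
    case False
    then show ?thesis
      using assms[of s] by (simp add: conjugate_def Bij_def extensional_def)
  qed
qed

text \<open>A tuple of \<open>f2\<close> is pulled back to \<open>f1\<close> along \<mu>, moved
  inside \<open>f1\<close> by \<open>g\<close>, and pushed forward to \<open>f2\<close>.\<close>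

lemma conjugate_in_Aut:
  assumes f1: "f1 \<in> interpretations A \<Phi>" and f2: "f2 \<in> interpretations B \<Phi>"
    and rel: "\<And>\<phi> xs. \<phi> \<in> rel_symbols \<Phi> \<Longrightarrow> xs \<in> tuples A (rel_type \<Phi> \<phi>) \<Longrightarrow>
      xs \<in> f1 \<phi> \<longleftrightarrow> map2 \<mu> (rel_type \<Phi> \<phi>) xs \<in> f2 \<phi>"
    and g: "g \<in> Aut (A, \<Phi>, f1)"
  shows "conjugate A B \<mu> g \<in> Aut (B, \<Phi>, f2)"
proof -
  have "map2 (conjugate A B \<mu> g) (rel_type \<Phi> \<phi>) xs \<in> f2 \<phi>"
    if \<phi>: "\<phi> \<in> rel_symbols \<Phi>" and xs: "xs \<in> f2 \<phi>" for \<phi> xs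
  proof -
    let ?ss = "rel_type \<Phi> \<phi>"
    let ?ys = "map2 (family_inv A \<mu>) ?ss xs"
    have xsB: "xs \<in> tuples B ?ss"
      using f2 \<phi> xs by (auto simp: interpretations_def)
    have ysA: "?ys \<in> tuples A ?ss"
      by (rule map2_in_tuples[OF family_inv_closed xsB])
    have "?ys \<in> f1 \<phi>"
      using rel[OF \<phi> ysA] xs by (simp only: map2_family_inv_right[OF xsB])
    then have gys: "map2 g ?ss ?ys \<in> f1 \<phi>"
      using g \<phi> by auto
    \<comment> \<open>The equivalence \<open>rel\<close> speaks of well-sorted tuples only;
      \<open>f1\<close> being an interpretation provides this.\<close>
    moreover from gys have "map2 g ?ss ?ys \<in> tuples A ?ss"
      using f1 \<phi> by (auto simp: interpretations_def)
    ultimately have "map2 \<mu> ?ss (map2 g ?ss ?ys) \<in> f2 \<phi>"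
      using rel[OF \<phi>] by blast
    also have "map2 \<mu> ?ss (map2 g ?ss ?ys) = map2 (conjugate A B \<mu> g) ?ss xs"
      using xsB by (intro nth_equalityI) (auto simp: tuples_iff_nth conjugate_def)
    finally show ?thesis .
  qed
  then show ?thesis
    using g conjugate_Bij by auto
qed

end

lemma Aut_model_iso:
  assumes iso: "model_iso \<Theta> \<Phi> A f1 B f2 \<mu>"
    and f1: "f1 \<in> interpretations A \<Phi>" and f2: "f2 \<in> interpretations B \<Phi>"
  shows "Aut (B, \<Phi>, f2) = conjugate A B \<mu> ` Aut (A, \<Phi>, f1)"
proof -
  have bij: "\<And>s. bij_betw (\<mu> s) (sort_carrier A s) (sort_carrier B s)"
    and rel: "\<And>\<phi> xs. \<phi> \<in> rel_symbols \<Phi> \<Longrightarrow> xs \<in> tuples A (rel_type \<Phi> \<phi>) \<Longrightarrow>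
      xs \<in> f1 \<phi> \<longleftrightarrow> map2 \<mu> (rel_type \<Phi> \<phi>) xs \<in> f2 \<phi>"
    using iso by (auto simp: model_iso_def algebra_iso_def)
  \<comment> \<open>This is \<open>rel\<close> read along the inverse family, as needed to apply
    \<open>conjugate_in_Aut\<close> from \<open>B\<close> to \<open>A\<close>.\<close>
  have rel': "xs \<in> f2 \<phi> \<longleftrightarrow> map2 (family_inv A \<mu>) (rel_type \<Phi> \<phi>) xs \<in> f1 \<phi>"
    if "\<phi> \<in> rel_symbols \<Phi>" "xs \<in> tuples B (rel_type \<Phi> \<phi>)" for \<phi> xs
    using rel[OF that(1) map2_in_tuples[OF family_inv_closed[OF bij] that(2)]]
    by (simp only: map2_family_inv_right[OF bij that(2)])
  show ?thesis
  proof (intro equalityI subsetI)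
    fix g assume g: "g \<in> Aut (B, \<Phi>, f2)"
    have "conjugate B A (family_inv A \<mu>) g \<in> Aut (A, \<Phi>, f1)"
      by (rule conjugate_in_Aut[OF bij_betw_family_inv[OF bij] f2 f1 rel' g])
    moreover have "g = conjugate A B \<mu> (conjugate B A (family_inv A \<mu>) g)"
      using g by (intro conjugate_conjugate_family_inv[OF bij, symmetric]) auto
    ultimately show "g \<in> conjugate A B \<mu> ` Aut (A, \<Phi>, f1)"
      by blast
  next
    fix g assume "g \<in> conjugate A B \<mu> ` Aut (A, \<Phi>, f1)"
    then show "g \<in> Aut (B, \<Phi>, f2)"
      using conjugate_in_Aut[OF bij f1 f2 rel] by auto
  qed
qed

lemma transport_in_interpretations: "transport A \<Phi> \<sigma> f \<in> interpretations A \<Phi>"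
  by (auto simp: transport_def interpretations_def)

text \<open>On well-sorted tuples the inverse family in \<open>transport\<close> cancels \<sigma>,
  which leaves membership in \<open>f \<phi>\<close>.\<close>

lemma model_iso_transport:
  assumes "algebra_aut \<Theta> A \<sigma>"
  shows "model_iso \<Theta> \<Phi> A f A (transport A \<Phi> \<sigma> f) \<sigma>"
proof -
  have bij: "\<And>s. bij_betw (\<sigma> s) (sort_carrier A s) (sort_carrier A s)"
    using assms by (simp add: algebra_iso_def)
  have "xs \<in> f \<phi> \<longleftrightarrow> map2 \<sigma> (rel_type \<Phi> \<phi>) xs \<in> transport A \<Phi> \<sigma> f \<phi>"
    if "\<phi> \<in> rel_symbols \<Phi>" "xs \<in> tuples A (rel_type \<Phi> \<phi>)" for \<phi> xs
  proof -
    have "map2 \<sigma> (rel_type \<Phi> \<phi>) xs \<in> tuples A (rel_type \<Phi> \<phi>)"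
      by (rule map2_in_tuples[OF family_closed[OF bij] that(2)])
    then show ?thesis
      unfolding transport_def restrict_apply'[OF that(1)] mem_Collect_eq
        map2_family_inv_left[OF bij that(2)] by simp
  qed
  then show ?thesis
    using assms by (simp add: model_iso_def)
qed

text \<open>Since \<sigma> is a model isomorphism onto the transported interpretation, the latter
  decides which well-sorted tuples lie in \<open>f \<phi>\<close>, and an interpretation contains no
  others.\<close>

lemma inj_on_transport:
  assumes "algebra_aut \<Theta> A \<sigma>"
  shows "inj_on (transport A \<Phi> \<sigma>) (interpretations A \<Phi>)"
proof (intro inj_onI)
  fix f g
  assume f: "f \<in> interpretations A \<Phi>" and g: "g \<in> interpretations A \<Phi>"
    and eq: "transport A \<Phi> \<sigma> f = transport A \<Phi> \<sigma> g"
  have "f \<phi> = g \<phi>" if \<phi>: "\<phi> \<in> rel_symbols \<Phi>" for \<phi>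
  proof -
    have "xs \<in> f \<phi> \<longleftrightarrow> xs \<in> g \<phi>" if "xs \<in> tuples A (rel_type \<Phi> \<phi>)" for xs
      using model_iso_transport[OF assms, of \<Phi> f] model_iso_transport[OF assms, of \<Phi> g] \<phi> that
      unfolding model_iso_def eq by blast
    moreover have "f \<phi> \<subseteq> tuples A (rel_type \<Phi> \<phi>)" "g \<phi> \<subseteq> tuples A (rel_type \<Phi> \<phi>)"
      using f g \<phi> by (auto simp: interpretations_def)
    ultimately show ?thesis by blast
  qed
  \<comment> \<open>Agreement on the relation symbols suffices because interpretations are
    extensional.\<close>
  then show "f = g"
    using f g unfolding interpretations_def by (intro PiE_ext) auto
qed

theorem mainTheorem2:
  fixes \<Theta> :: "('s, 'o) variety"
    and A :: "('s, 'o, 'a) algebra"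
    and \<Phi> :: "('s, 'r) relations"
    and F F\<^sub>1 :: "('r \<Rightarrow> 'a list set) set"
    and \<sigma> :: "'s \<Rightarrow> 'a \<Rightarrow> 'a"
  assumes "is_variety \<Theta>"
    and "finite_multi_model \<Theta> (A, \<Phi>, F)"
    and "algebra_aut \<Theta> A \<sigma>"
    and "F\<^sub>1 = {transport A \<Phi> \<sigma> f | f. f \<in> F}"
  shows "finite_multi_model \<Theta> (A, \<Phi>, F\<^sub>1) \<and>
    bij_betw (transport A \<Phi> \<sigma>) F F\<^sub>1 \<and>
    (\<forall>f \<in> F. model_iso \<Theta> \<Phi> A f A (transport A \<Phi> \<sigma> f) \<sigma> \<and>
       Aut (A, \<Phi>, transport A \<Phi> \<sigma> f) = conjugate A A \<sigma> ` Aut (A, \<Phi>, f)) \<and>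
    aut_equiv_multi_models \<Theta> (A, \<Phi>, F) (A, \<Phi>, F\<^sub>1)"
proof -
  have F: "F \<subseteq> interpretations A \<Phi>"
    using assms(2) by simp
  have F1: "F\<^sub>1 = transport A \<Phi> \<sigma> ` F"
    using assms(4) by auto
  \<comment> \<open>The algebra is unchanged, so only the inclusion of \<open>F\<^sub>1\<close> in
    the interpretations has to be checked.\<close>
  have fin: "finite_multi_model \<Theta> (A, \<Phi>, F\<^sub>1)"
    using assms(2) F1 transport_in_interpretations by auto
  have bij: "bij_betw (transport A \<Phi> \<sigma>) F F\<^sub>1"
    unfolding F1 by (intro inj_on_imp_bij_betw inj_on_subset[OF inj_on_transport[OF assms(3)] F])
  have aut: "Aut (A, \<Phi>, transport A \<Phi> \<sigma> f) = conjugate A A \<sigma> ` Aut (A, \<Phi>, f)" if "f \<in> F" for f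
    using Aut_model_iso[OF model_iso_transport[OF assms(3)] _ transport_in_interpretations] F that
    by blast
  \<comment> \<open>The witness for \<mu> is \<sigma> itself, the same for all \<open>f\<close>; the
    bijection \<alpha> below is \<open>transport A \<Phi> \<sigma>\<close>.\<close>
  have "aut_equiv_models \<Theta> (A, \<Phi>, f) (A, \<Phi>, transport A \<Phi> \<sigma> f)" if "f \<in> F" for f
    unfolding aut_equiv_models.simps using assms(3) aut[OF that] by blast
  then have "aut_equiv_multi_models \<Theta> (A, \<Phi>, F) (A, \<Phi>, F\<^sub>1)"
    unfolding aut_equiv_multi_models.simps using bij by blast
  then show ?thesis
    using fin bij model_iso_transport[OF assms(3)] aut by blast
qed

end
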